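(* Let $X$ be a mean-zero random vector in $\mathbb{R}^p$ with finite second moments and let $Y=b^*X+\varepsilon$ be a real-valued random variable with finite second moment, where $b^*\in\mathbb{R}^{1\times p}$ and $\varepsilon$ is a real random variable. Let $U\sim U[0,1]$ and let $b\in\mathbb{R}^{1\times p}$ be fixed. Then $$\inf_{q\in\mathcal{M}}\mathbb{E}\Bigl\{\int_0^1\rho_\tau\bigl(Y-bX-q(\tau)\bigr)\,d\tau\Bigr\}+\frac12\mathbb{E}Y=\langle\!\langle Y-bX,U\rangle\!\rangle_{\mathcal{W}_2}.$$
   Context: $\rho_\tau(t):=\max\{t,0\}+(\tau-1)t$ is the check function. $\mathcal{M}$ is the set of all (non-strictly) increasing real-valued functions on $(0,1)$. For $P,Q\in\mathcal{P}_2(\mathbb{R})$ (Borel probability measures with finite second moment), $\langle\!\langle P,Q\rangle\!\rangle_{\mathcal{W}_2}:=\sup_{\gamma\in\mathcal{C}(P,Q)}\int xy\,d\gamma(x,y)$, where $\mathcal{C}(P,Q)$ is the set of couplings of $P$ and $Q$; $\langle\!\langle V,W\rangle\!\rangle_{\mathcal{W}_2}$ for random variables $V,W$ means $\langle\!\langle P^V,P^W\rangle\!\rangle_{\mathcal{W}_2}$, with $P^V$ the law of $V$. *)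

theory Defs
  imports "HOL-Probability.Probability"
begin

definition check_fun :: "real \<Rightarrow> real \<Rightarrow> real"
  where "check_fun \<tau> t = max t 0 + (\<tau> - 1) * t"

text \<open>Functions on \<open>(0,1)\<close> are represented by total functions whose values outside \<open>(0,1)\<close>
  are arbitrary and never used.\<close>

definition increasing_funs :: "(real \<Rightarrow> real) set"
  where "increasing_funs = {q. mono_on {0<..<1} q}"

definition couplings :: "'a measure \<Rightarrow> 'b measure \<Rightarrow> ('a \<times> 'b) measure set"
  where "couplings P Q =
    {\<gamma>. prob_space \<gamma> \<and> sets \<gamma> = sets (P \<Otimes>\<^sub>M Q) \<and> distr \<gamma> P fst = P \<and> distr \<gamma> Q snd = Q}"

text \<open>Intended for Borel probability measures with finite second moment. There the integrals
  converge absolutely by Cauchy-Schwarz, so the Bochner integral carries no junk value. The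
  supremum is taken in \<^typ>\<open>ereal\<close>, where it needs no boundedness side condition.\<close>

definition w2_inner :: "real measure \<Rightarrow> real measure \<Rightarrow> ereal"
  where "w2_inner P Q = (SUP \<gamma>\<in>couplings P Q. ereal (\<integral>z. fst z * snd z \<partial>\<gamma>))"

text \<open>The two random variables may live on different probability spaces, since only their laws
  matter.\<close>

definition w2_inner_rv ::
    "'a measure \<Rightarrow> ('a \<Rightarrow> real) \<Rightarrow> 'b measure \<Rightarrow> ('b \<Rightarrow> real) \<Rightarrow> ereal"
  where "w2_inner_rv M V N W = w2_inner (distr M borel V) (distr N borel W)"

text \<open>The integrand is nonnegative for \<open>\<tau> \<in> (0,1)\<close>, so the expectation is taken as a
  nonnegative integral, with value \<open>\<infinity>\<close> when it diverges (which happens for some \<open>q\<close>).\<close>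

definition expected_check_loss :: "'a measure \<Rightarrow> ('a \<Rightarrow> real) \<Rightarrow> (real \<Rightarrow> real) \<Rightarrow> ennreal"
  where "expected_check_loss M Z q =
    (\<integral>\<^sup>+\<omega>. (\<integral>\<^sup>+\<tau>\<in>{0<..<1}. ennreal (check_fun \<tau> (Z \<omega> - q \<tau>)) \<partial>lborel) \<partial>M)"

end

theory Submission
  imports Defs
begin

text \<open>
  The slopes \<open>\<tau> - 1\<close> and \<open>\<tau>\<close> of the check function satisfy \<open>s * t \<le> \<rho>\<^sub>\<tau> t\<close>. Given a coupling of
  \<open>Z\<close> with a uniform \<open>U\<close>, choose the slope \<open>\<tau>\<close> if \<open>\<tau> < U\<close> and \<open>\<tau> - 1\<close> otherwise. For fixed \<open>\<tau>\<close> this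
  slope has mean zero, so that \<open>q \<tau>\<close> drops out of the lower bound for \<open>E \<rho>\<^sub>\<tau> (Z - q \<tau>)\<close>; for fixed
  \<open>U\<close> its integral over \<open>\<tau>\<close> is \<open>U - 1/2\<close>. Hence every \<open>q\<close> has loss at least \<open>E (U - 1/2) Z\<close>. All
  inequalities are equalities if \<open>q\<close> is the quantile function of \<open>Z\<close> and \<open>Z = q U\<close>.
\<close>

section \<open>The check function, its slopes and the unit interval\<close>

abbreviation unit_lborel :: "real measure"
  where "unit_lborel \<equiv> restrict_space lborel {0<..<1}"

text \<open>A subgradient of \<open>check_fun \<tau>\<close> at every point t that has the same sign
  as u - \<tau>.\<close>

definition check_slope :: "real \<Rightarrow> real \<Rightarrow> real"
  where "check_slope \<tau> u = (if \<tau> < u then \<tau> else \<tau> - 1)"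

lemma abs_check_slope_le: "\<tau> \<in> {0<..<1} \<Longrightarrow> \<bar>check_slope \<tau> u\<bar> \<le> 1"
  by (auto simp: check_slope_def)

text \<open>The check function is the maximum of the two linear functions with slopes \<tau> and
  \<tau> - 1.\<close>

lemma check_slope_mult_le: "check_slope \<tau> u * t \<le> check_fun \<tau> t"
  by (auto simp: check_slope_def check_fun_def max_def algebra_simps)

text \<open>The slope chosen by u is the one whose linear function attains the maximum at t. At t =
  0 both do, which is why both conditions are non-strict in t.\<close>

lemma check_slope_mult_eq:
  assumes "\<tau> < u \<Longrightarrow> 0 \<le> t" and "u \<le> \<tau> \<Longrightarrow> t \<le> 0"
  shows "check_slope \<tau> u * t = check_fun \<tau> t"
  using assms by (auto simp: check_slope_def check_fun_def max_def algebra_simps)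

lemma check_fun_nonneg:
  assumes "\<tau> \<in> {0<..<1}"
  shows "0 \<le> check_fun \<tau> t"
  using assms mult_nonneg_nonneg[of \<tau> t] mult_nonpos_nonpos[of "\<tau> - 1" t]
  by (auto simp: check_fun_def max_def algebra_simps)

lemma prob_space_unit_lborel: "prob_space unit_lborel"
  by (rule prob_space_restrict_space) auto

text \<open>Increasing functions live on the open interval, while the uniform law is given on the
  closed one. The two differ by two null points.\<close>

lemma distr_unit_lborel: "distr unit_lborel borel (\<lambda>\<tau>. \<tau>) = uniform_measure lborel {0..1}"
proof (rule measure_eqI)
  fix A assume "A \<in> sets (distr unit_lborel borel (\<lambda>\<tau>. \<tau>))"
  then have [measurable]: "A \<in> sets borel" by simp
  have "emeasure (distr unit_lborel borel (\<lambda>\<tau>. \<tau>)) A = emeasure lborel (A \<inter> {0<..<1})"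
    by (subst emeasure_distr)
       (auto simp: space_restrict_space emeasure_restrict_space intro: measurable_restrict_space1)
  also have "\<dots> = emeasure lborel (A \<inter> {0..1})"
    using AE_lborel_singleton[of 0] AE_lborel_singleton[of 1]
    by (intro emeasure_eq_AE) (auto elim!: eventually_elim2)
  finally show "emeasure (distr unit_lborel borel (\<lambda>\<tau>. \<tau>)) A = emeasure (uniform_measure lborel {0..1}) A"
    by (simp add: Int_commute divide_ennreal_def)
qed simp

text \<open>The slope is \<tau> minus the indicator of u \<le> \<tau>. Over the unit interval these
  integrate to 1/2 and 1 - u.\<close>

lemma integral_check_slope:
  assumes "u \<in> {0<..<1}"
  shows "(\<integral>\<tau>. check_slope \<tau> u \<partial>unit_lborel) = u - 1/2"
proof -
  interpret prob_space unit_lborel by (rule prob_space_unit_lborel)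
  have id: "(\<lambda>\<tau>. \<tau>) \<in> borel_measurable unit_lborel"
    by (auto intro: measurable_restrict_space1)
  have int: "integrable unit_lborel (\<lambda>\<tau>. \<tau>)"
    by (rule integrable_const_bound[of _ 1]) (auto simp: id AE_restrict_space_iff)
  have 1: "(\<integral>\<tau>. \<tau> \<partial>unit_lborel) = 1/2"
  proof -
    have "(\<integral>\<tau>. \<tau> \<partial>unit_lborel) = (\<integral>\<tau>\<in>{0<..<1}. \<tau> \<partial>lborel)"
      by (simp add: integral_restrict_space set_lebesgue_integral_def)
    \<comment> \<open>Adding the two null endpoints gives the form that
      \<open>integral_power\<close> evaluates.\<close>
    also have "\<dots> = (\<integral>\<tau>. \<tau> * indicator {0..1} \<tau> \<partial>lborel)"
      unfolding set_lebesgue_integral_def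
      using AE_lborel_singleton[of 0] AE_lborel_singleton[of 1]
      by (intro integral_cong_AE) (auto elim!: eventually_elim2 simp: indicator_def)
    also have "\<dots> = 1/2"
      using integral_power[of 0 1 1] by simp
    finally show ?thesis .
  qed
  have 2: "(\<integral>\<tau>. indicator {u..} \<tau> \<partial>unit_lborel) = 1 - u"
  proof -
    have "(\<integral>\<tau>. indicat_real {u..} \<tau> \<partial>unit_lborel) = (\<integral>\<tau>. indicator {u..<1} \<tau> \<partial>lborel)"
      using assms
      by (auto simp: integral_restrict_space indicator_def intro!: Bochner_Integration.integral_cong)
    with assms show ?thesis by simp
  qed
  have "(\<integral>\<tau>. check_slope \<tau> u \<partial>unit_lborel) = (\<integral>\<tau>. \<tau> - indicator {u..} \<tau> \<partial>unit_lborel)"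
    by (intro Bochner_Integration.integral_cong) (auto simp: check_slope_def)
  also have "\<dots> = (\<integral>\<tau>. \<tau> \<partial>unit_lborel) - (\<integral>\<tau>. indicator {u..} \<tau> \<partial>unit_lborel)"
    using id by (intro Bochner_Integration.integral_diff int integrable_const_bound[of _ 1])
      (auto intro: borel_measurable_indicator measurable_restrict_space1)
  finally show ?thesis using 1 2 by simp
qed

section \<open>Measurability of the loss and its dependence on the law alone\<close>

lemma expected_check_loss_eq:
  "expected_check_loss M Z q =
    (\<integral>\<^sup>+\<omega>. (\<integral>\<^sup>+\<tau>. ennreal (check_fun \<tau> (Z \<omega> - q \<tau>)) \<partial>unit_lborel) \<partial>M)"
  unfolding expected_check_loss_def by (simp add: nn_integral_restrict_space)

text \<open>Values of \<open>q\<close> outside the unit interval are arbitrary, so measurability is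
  claimed on the restricted space only, where monotonicity provides it.\<close>

lemma increasing_funs_measurable:
  assumes "q \<in> increasing_funs"
  shows "q \<in> borel_measurable unit_lborel"
proof -
  have "q \<in> borel_measurable (restrict_space borel {0<..<1})"
    using assms by (auto simp: increasing_funs_def intro: borel_measurable_mono_on_fnc)
  moreover have "sets unit_lborel = sets (restrict_space borel {0<..<1})"
    by (simp cong: sets_restrict_space_cong)
  ultimately show ?thesis
    by (simp cong: measurable_cong_sets)
qed

lemma check_loss_measurable:
  assumes [measurable]: "q \<in> borel_measurable unit_lborel" "Z \<in> borel_measurable M"
  shows "(\<lambda>(\<omega>, \<tau>). ennreal (check_fun \<tau> (Z \<omega> - q \<tau>))) \<in> borel_measurable (M \<Otimes>\<^sub>M unit_lborel)"
proof -
  have [measurable]: "(\<lambda>\<tau>. \<tau>) \<in> borel_measurable unit_lborel"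
    by (auto intro: measurable_restrict_space1)
  show ?thesis unfolding check_fun_def by measurable
qed

text \<open>The inner integral is a Borel function of the value of \<open>Z\<close>. This lets the
  loss be moved from the original space to that of a coupling.\<close>

lemma expected_check_loss_distr:
  assumes q: "q \<in> borel_measurable unit_lborel" and Z[measurable]: "Z \<in> borel_measurable M"
  shows "expected_check_loss (distr M borel Z) (\<lambda>z. z) q = expected_check_loss M Z q"
proof -
  interpret prob_space unit_lborel by (rule prob_space_unit_lborel)
  have "(\<lambda>z. \<integral>\<^sup>+\<tau>. ennreal (check_fun \<tau> (z - q \<tau>)) \<partial>unit_lborel) \<in> borel_measurable borel"
    using check_loss_measurable[OF q, of "\<lambda>z. z" borel]
    by (intro borel_measurable_nn_integral) auto
  then show ?thesis
    unfolding expected_check_loss_eq by (subst nn_integral_distr) auto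
qed

text \<open>Since \<open>ennreal\<close> sends negative reals to 0, the right-hand side is the
  integral of the positive part of \<open>f\<close>, which dominates \<open>f\<close>.\<close>

lemma ennreal_integral_le_nn_integral:
  fixes f :: "'a \<Rightarrow> real"
  assumes "integrable M f"
  shows "ennreal (\<integral>x. f x \<partial>M) \<le> (\<integral>\<^sup>+x. ennreal (f x) \<partial>M)"
proof -
  have "ennreal (\<integral>x. f x \<partial>M) \<le> ennreal (\<integral>x. max 0 (f x) \<partial>M)"
    using assms by (intro ennreal_leI integral_mono) auto
  also have "\<dots> = (\<integral>\<^sup>+x. ennreal (max 0 (f x)) \<partial>M)"
    using assms by (intro nn_integral_eq_integral[symmetric]) auto
  finally show ?thesis by (simp add: ennreal_max_0)
qed

section \<open>Bounds for the loss under a coupling with a uniform variable\<close>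

locale uniform_coupling = prob_space \<gamma> for \<gamma> :: "'c measure" +
  fixes Z U :: "'c \<Rightarrow> real"
  assumes Z_int: "integrable \<gamma> Z"
    and U_meas [measurable]: "U \<in> borel_measurable \<gamma>"
    and U_unif: "distr \<gamma> borel U = uniform_measure lborel {0..1}"
begin

lemma Z_meas [measurable]: "Z \<in> borel_measurable \<gamma>"
  using Z_int by auto

text \<open>The endpoints have to be excluded because \<open>integral_check_slope\<close> and the
  monotonicity of \<open>q\<close> are available on the open interval only.\<close>

lemma AE_U: "AE x in \<gamma>. U x \<in> {0<..<1}"
proof -
  have "AE u in uniform_measure lborel {0..1}. u \<in> {0<..<1::real}"
    using AE_lborel_singleton[of 0] AE_lborel_singleton[of 1]
    by (intro AE_uniform_measureI) (auto elim!: eventually_elim2)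
  then show ?thesis
    unfolding U_unif[symmetric] by (subst (asm) AE_distr_iff) auto
qed

text \<open>The slope is \<tau> - 1 plus the indicator of \<tau> < U, an event of probability 1 -
  \<tau>.\<close>

lemma mean_slope:
  assumes "\<tau> \<in> {0<..<1}"
  shows "(\<integral>x. check_slope \<tau> (U x) \<partial>\<gamma>) = 0"
proof -
  have "prob {x \<in> space \<gamma>. \<tau> < U x} = measure (distr \<gamma> borel U) {\<tau><..}"
    by (subst measure_distr) (auto intro: arg_cong[where f = prob])
  also have "\<dots> = measure lborel ({0..1} \<inter> {\<tau><..})"
    unfolding U_unif by (subst measure_uniform_measure) auto
  also have "{0..1} \<inter> {\<tau><..} = {\<tau><..1}"
    using assms by auto
  finally have P: "prob {x \<in> space \<gamma>. \<tau> < U x} = 1 - \<tau>"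
    using assms by simp
  have "integrable \<gamma> (indicat_real {x \<in> space \<gamma>. \<tau> < U x})"
    by (intro integrable_real_indicator) (auto simp: emeasure_eq_measure)
  then have int: "(\<integral>x. indicator {x \<in> space \<gamma>. \<tau> < U x} x + (\<tau> - 1) \<partial>\<gamma>) =
      prob {x \<in> space \<gamma>. \<tau> < U x} + (\<tau> - 1)"
    by (subst Bochner_Integration.integral_add) (auto simp: prob_space)
  have "(\<integral>x. check_slope \<tau> (U x) \<partial>\<gamma>) =
      (\<integral>x. indicator {x \<in> space \<gamma>. \<tau> < U x} x + (\<tau> - 1) \<partial>\<gamma>)"
    by (intro Bochner_Integration.integral_cong) (auto simp: check_slope_def indicator_def)
  then show ?thesis using P int by simp
qed

lemma integrable_slope_mult:
  assumes "\<tau> \<in> {0<..<1}" "integrable \<gamma> V"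
  shows "integrable \<gamma> (\<lambda>x. check_slope \<tau> (U x) * V x)"
proof (rule Bochner_Integration.integrable_bound[OF assms(2)])
  show "(\<lambda>x. check_slope \<tau> (U x) * V x) \<in> borel_measurable \<gamma>"
    unfolding check_slope_def using assms(2) by measurable
  show "AE x in \<gamma>. norm (check_slope \<tau> (U x) * V x) \<le> norm (V x)"
    using abs_check_slope_le[OF assms(1)] by (auto simp: abs_mult mult_left_le_one_le)
qed

text \<open>The constant is multiplied by the mean slope, which vanishes.\<close>

lemma integral_slope_shift:
  assumes "\<tau> \<in> {0<..<1}"
  shows "(\<integral>x. check_slope \<tau> (U x) * (Z x - c) \<partial>\<gamma>) = (\<integral>x. check_slope \<tau> (U x) * Z x \<partial>\<gamma>)"
  using integrable_slope_mult[OF assms Z_int] integrable_slope_mult[OF assms, of "\<lambda>_. c"]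
    mean_slope[OF assms]
  by (simp add: right_diff_distrib)

text \<open>The slope is bounded by 1, so \<open>Z\<close> dominates the product, and
  \<open>Z\<close> stays integrable when a factor of total mass 1 is added. This justifies the use
  of Fubini for signed integrands.\<close>

lemma integrable_slope_product:
  "integrable (unit_lborel \<Otimes>\<^sub>M \<gamma>) (\<lambda>(\<tau>, x). check_slope \<tau> (U x) * Z x)"
proof -
  interpret J: prob_space unit_lborel by (rule prob_space_unit_lborel)
  interpret pair_prob_space unit_lborel \<gamma> ..
  have [measurable]: "(\<lambda>\<tau>. \<tau>) \<in> borel_measurable unit_lborel"
    by (auto intro: measurable_restrict_space1)
  have "integrable (unit_lborel \<Otimes>\<^sub>M \<gamma>) (\<lambda>(\<tau>, x). Z x)"
    by (rule Fubini_integrable) (use Z_int in auto)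
  then show ?thesis
  proof (rule Bochner_Integration.integrable_bound)
    show "(\<lambda>(\<tau>, x). check_slope \<tau> (U x) * Z x) \<in> borel_measurable (unit_lborel \<Otimes>\<^sub>M \<gamma>)"
      unfolding check_slope_def by measurable
    show "AE p in unit_lborel \<Otimes>\<^sub>M \<gamma>. norm (case p of (\<tau>, x) \<Rightarrow> check_slope \<tau> (U x) * Z x)
        \<le> norm (case p of (\<tau>, x) \<Rightarrow> Z x)"
      using abs_check_slope_le
      by (intro AE_I2) (auto simp: space_pair_measure space_restrict_space abs_mult
          intro!: mult_left_le_one_le)
  qed
qed

lemma
  shows integrable_slope_integral:
      "integrable unit_lborel (\<lambda>\<tau>. \<integral>x. check_slope \<tau> (U x) * Z x \<partial>\<gamma>)"
    and integral_slope_integral: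
      "(\<integral>\<tau>. (\<integral>x. check_slope \<tau> (U x) * Z x \<partial>\<gamma>) \<partial>unit_lborel) = (\<integral>x. (U x - 1/2) * Z x \<partial>\<gamma>)"
proof -
  interpret J: prob_space unit_lborel by (rule prob_space_unit_lborel)
  interpret pair_prob_space unit_lborel \<gamma> ..
  note int = integrable_slope_product
  show "integrable unit_lborel (\<lambda>\<tau>. \<integral>x. check_slope \<tau> (U x) * Z x \<partial>\<gamma>)"
    by (rule integrable_fst[OF int])
  have "(\<integral>\<tau>. (\<integral>x. check_slope \<tau> (U x) * Z x \<partial>\<gamma>) \<partial>unit_lborel) =
      (\<integral>x. (\<integral>\<tau>. check_slope \<tau> (U x) * Z x \<partial>unit_lborel) \<partial>\<gamma>)"
    by (rule Fubini_integral[symmetric, OF int])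
  also have "\<dots> = (\<integral>x. (U x - 1/2) * Z x \<partial>\<gamma>)"
  proof (rule integral_cong_AE)
    show "(\<lambda>x. \<integral>\<tau>. check_slope \<tau> (U x) * Z x \<partial>unit_lborel) \<in> borel_measurable \<gamma>"
      using integrable_snd[OF int] by auto
    show "AE x in \<gamma>. (\<integral>\<tau>. check_slope \<tau> (U x) * Z x \<partial>unit_lborel) = (U x - 1/2) * Z x"
      using AE_U by eventually_elim (simp add: integral_check_slope)
  qed measurable
  finally show "(\<integral>\<tau>. (\<integral>x. check_slope \<tau> (U x) * Z x \<partial>\<gamma>) \<partial>unit_lborel) =
    (\<integral>x. (U x - 1/2) * Z x \<partial>\<gamma>)" .
qed

text \<open>Both sides are the covariance of \<open>Z\<close> and \<open>U\<close>. Splitting it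
  requires integrability of \<open>Z * U\<close>, which holds as \<open>U\<close> lies in the unit
  interval almost surely.\<close>

lemma integral_centred:
  "(\<integral>x. (U x - 1/2) * Z x \<partial>\<gamma>) = (\<integral>x. Z x * U x \<partial>\<gamma>) - 1/2 * (\<integral>x. Z x \<partial>\<gamma>)"
proof -
  have "AE x in \<gamma>. norm (Z x * U x) \<le> norm (Z x)"
    using AE_U by eventually_elim (auto simp: abs_mult mult_left_le)
  then have "integrable \<gamma> (\<lambda>x. Z x * U x)"
    by (intro Bochner_Integration.integrable_bound[OF Z_int]) auto
  then show ?thesis
    using Z_int by (simp add: right_diff_distrib left_diff_distrib mult.commute)
qed

text \<open>Tonelli applies to the extended nonnegative integrand, so an infinite loss is covered
  too.\<close>

lemma expected_check_loss_swap:
  assumes "q \<in> borel_measurable unit_lborel"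
  shows "expected_check_loss \<gamma> Z q =
    (\<integral>\<^sup>+\<tau>. (\<integral>\<^sup>+x. ennreal (check_fun \<tau> (Z x - q \<tau>)) \<partial>\<gamma>) \<partial>unit_lborel)"
proof -
  interpret J: prob_space unit_lborel by (rule prob_space_unit_lborel)
  interpret pair_prob_space \<gamma> unit_lborel ..
  show ?thesis
    unfolding expected_check_loss_eq
    using Fubini'[OF check_loss_measurable[OF assms Z_meas]] by simp
qed

text \<open>The slope bound is integrated first over the coupling and then over \<tau>. The
  covariance on the left may be negative; \<open>ennreal\<close> then turns it into 0 and the claim
  is trivial.\<close>

lemma expected_check_loss_ge:
  assumes "q \<in> borel_measurable unit_lborel"
  shows "ennreal ((\<integral>x. Z x * U x \<partial>\<gamma>) - 1/2 * (\<integral>x. Z x \<partial>\<gamma>)) \<le> expected_check_loss \<gamma> Z q"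
proof -
  have "ennreal ((\<integral>x. Z x * U x \<partial>\<gamma>) - 1/2 * (\<integral>x. Z x \<partial>\<gamma>)) =
      ennreal (\<integral>\<tau>. (\<integral>x. check_slope \<tau> (U x) * Z x \<partial>\<gamma>) \<partial>unit_lborel)"
    by (simp only: integral_slope_integral integral_centred)
  also have "\<dots> \<le> (\<integral>\<^sup>+\<tau>. ennreal (\<integral>x. check_slope \<tau> (U x) * Z x \<partial>\<gamma>) \<partial>unit_lborel)"
    by (intro ennreal_integral_le_nn_integral integrable_slope_integral)
  also have "\<dots> \<le> (\<integral>\<^sup>+\<tau>. (\<integral>\<^sup>+x. ennreal (check_fun \<tau> (Z x - q \<tau>)) \<partial>\<gamma>) \<partial>unit_lborel)"
  proof (rule nn_integral_mono)
    fix \<tau> assume "\<tau> \<in> space unit_lborel"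
    then have \<tau>: "\<tau> \<in> {0<..<1}" by (simp add: space_restrict_space)
    \<comment> \<open>Subtracting \<open>q \<tau>\<close> leaves the integral unchanged and produces
      the argument at which the slope bound is to be used.\<close>
    have "ennreal (\<integral>x. check_slope \<tau> (U x) * Z x \<partial>\<gamma>) =
        ennreal (\<integral>x. check_slope \<tau> (U x) * (Z x - q \<tau>) \<partial>\<gamma>)"
      by (simp only: integral_slope_shift[OF \<tau>])
    also have "\<dots> \<le> (\<integral>\<^sup>+x. ennreal (check_slope \<tau> (U x) * (Z x - q \<tau>)) \<partial>\<gamma>)"
      using Z_int by (intro ennreal_integral_le_nn_integral integrable_slope_mult[OF \<tau>]) auto
    also have "\<dots> \<le> (\<integral>\<^sup>+x. ennreal (check_fun \<tau> (Z x - q \<tau>)) \<partial>\<gamma>)"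
      by (intro nn_integral_mono ennreal_leI check_slope_mult_le)
    finally show "ennreal (\<integral>x. check_slope \<tau> (U x) * Z x \<partial>\<gamma>) \<le>
      (\<integral>\<^sup>+x. ennreal (check_fun \<tau> (Z x - q \<tau>)) \<partial>\<gamma>)" .
  qed
  finally show ?thesis by (simp only: expected_check_loss_swap[OF assms])
qed

text \<open>The equality case of the lower bound. Here the covariance is an integral of nonnegative
  terms, so it appears as a real without truncation at 0.\<close>

lemma expected_check_loss_quantile:
  assumes q: "q \<in> increasing_funs" and Z: "AE x in \<gamma>. Z x = q (U x)"
  shows "enn2ereal (expected_check_loss \<gamma> Z q) =
    ereal ((\<integral>x. Z x * U x \<partial>\<gamma>) - 1/2 * (\<integral>x. Z x \<partial>\<gamma>))"
proof -
  define L where "L \<tau> = (\<integral>x. check_slope \<tau> (U x) * Z x \<partial>\<gamma>)" for \<tau>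
  \<comment> \<open>Nonnegativity of \<open>L\<close> is carried along because only then does the
    integral of \<open>ennreal (L \<tau>)\<close> agree with the Bochner integral of
    \<open>L\<close>.\<close>
  have *: "0 \<le> L \<tau> \<and> (\<integral>\<^sup>+x. ennreal (check_fun \<tau> (Z x - q \<tau>)) \<partial>\<gamma>) = ennreal (L \<tau>)"
    if \<tau>: "\<tau> \<in> {0<..<1}" for \<tau>
  proof -
    have eq: "AE x in \<gamma>. check_slope \<tau> (U x) * (Z x - q \<tau>) = check_fun \<tau> (Z x - q \<tau>)"
      using AE_U Z
    proof eventually_elim
      case (elim x)
      \<comment> \<open>As \<open>q\<close> is increasing and \<open>Z x = q (U x)\<close>, the
        difference \<open>Z x - q \<tau>\<close> is nonnegative if \<tau> < U x and nonpositive if U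
        x \<le> \<tau>.\<close>
      with q \<tau> show ?case
        by (intro check_slope_mult_eq) (auto simp: increasing_funs_def intro: mono_onD)
    qed
    have nonneg: "AE x in \<gamma>. 0 \<le> check_slope \<tau> (U x) * (Z x - q \<tau>)"
      using eq by eventually_elim (simp add: check_fun_nonneg[OF \<tau>])
    have "(\<integral>\<^sup>+x. ennreal (check_fun \<tau> (Z x - q \<tau>)) \<partial>\<gamma>) =
        (\<integral>\<^sup>+x. ennreal (check_slope \<tau> (U x) * (Z x - q \<tau>)) \<partial>\<gamma>)"
      using eq by (intro nn_integral_cong_AE) auto
    also have "\<dots> = ennreal (\<integral>x. check_slope \<tau> (U x) * (Z x - q \<tau>) \<partial>\<gamma>)"
      using Z_int by (intro nn_integral_eq_integral nonneg integrable_slope_mult[OF \<tau>]) auto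
    finally show ?thesis
      using integral_nonneg_AE[OF nonneg] unfolding L_def integral_slope_shift[OF \<tau>] by simp
  qed
  have "expected_check_loss \<gamma> Z q = (\<integral>\<^sup>+\<tau>. ennreal (L \<tau>) \<partial>unit_lborel)"
    unfolding expected_check_loss_swap[OF increasing_funs_measurable[OF q]]
    using * by (intro nn_integral_cong) (simp add: space_restrict_space)
  also have "\<dots> = ennreal (\<integral>\<tau>. L \<tau> \<partial>unit_lborel)"
    using * integrable_slope_integral unfolding L_def
    by (intro nn_integral_eq_integral) (auto simp: space_restrict_space intro!: AE_I2)
  finally have "expected_check_loss \<gamma> Z q = ennreal (\<integral>\<tau>. L \<tau> \<partial>unit_lborel)" .
  moreover have "0 \<le> (\<integral>\<tau>. L \<tau> \<partial>unit_lborel)"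
    using * by (intro Bochner_Integration.integral_nonneg) (simp add: space_restrict_space)
  ultimately show ?thesis
    unfolding L_def by (simp add: integral_slope_integral integral_centred)
qed

end

section \<open>Couplings with the uniform law and the quantile coupling\<close>

lemma distr_coupling_fst:
  assumes \<gamma>: "\<gamma> \<in> couplings P Q" and "sets P = sets borel"
  shows "distr \<gamma> borel fst = P"
proof -
  \<comment> \<open>The target measure of \<open>distr\<close> matters only through its measurable
    sets.\<close>
  have "distr \<gamma> borel fst = distr \<gamma> P fst"
    using assms(2) by (intro distr_cong) auto
  also have "\<dots> = P"
    using \<gamma> unfolding couplings_def by blast
  finally show ?thesis .
qed

lemma distr_coupling_snd:
  assumes \<gamma>: "\<gamma> \<in> couplings P Q" and "sets Q = sets borel"
  shows "distr \<gamma> borel snd = Q"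
proof -
  have "distr \<gamma> borel snd = distr \<gamma> Q snd"
    using assms(2) by (intro distr_cong) auto
  also have "\<dots> = Q"
    using \<gamma> unfolding couplings_def by blast
  finally show ?thesis .
qed

lemma uniform_coupling_couplings:
  assumes \<gamma>: "\<gamma> \<in> couplings P (uniform_measure lborel {0..1})"
    and P: "sets P = sets borel" "integrable P (\<lambda>z. z)"
  shows "uniform_coupling \<gamma> fst snd"
proof -
  have sets: "sets \<gamma> = sets (borel \<Otimes>\<^sub>M borel :: (real \<times> real) measure)"
    using \<gamma> P by (simp add: couplings_def cong: sets_pair_measure_cong)
  then have m: "fst \<in> borel_measurable \<gamma>" "snd \<in> borel_measurable \<gamma>"
    by (simp_all cong: measurable_cong_sets)
  interpret prob_space \<gamma> using \<gamma> by (simp add: couplings_def)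
  show ?thesis
  proof
    show "integrable \<gamma> fst"
      using P(2) integrable_distr_eq[OF m(1), of "\<lambda>z. z"]
      unfolding distr_coupling_fst[OF \<gamma> P(1)] by simp
    show "distr \<gamma> borel snd = uniform_measure lborel {0..1}"
      by (rule distr_coupling_snd[OF \<gamma>]) simp
  qed (rule m)
qed

text \<open>Inverse transform sampling: the uniform law is pushed forward along \<tau> to
  (\<open>q \<tau>\<close>, \<tau>), where \<open>q\<close> is the generalized inverse of the
  distribution function.\<close>

lemma quantile_coupling:
  assumes "real_distribution P"
  obtains q \<gamma> where "q \<in> increasing_funs" "\<gamma> \<in> couplings P (uniform_measure lborel {0..1})"
    "AE x in \<gamma>. fst x = q (snd x)"
proof -
  interpret P: real_distribution P by fact
  interpret P: cdf_distribution P ..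
  \<comment> \<open>\<open>P.I\<close> is controlled on the unit interval only. Extending it by 0
    makes \<open>q\<close> Borel on the whole line, and the scaled indicator is the form in which
    \<open>borel_measurable_restrict_space_iff\<close> expresses this.\<close>
  define q where "q \<tau> = indicator {0<..<1} \<tau> *\<^sub>R P.I \<tau>" for \<tau>
  have q_eq: "q \<tau> = P.I \<tau>" if "\<tau> \<in> space unit_lborel" for \<tau>
    using that by (simp add: q_def space_restrict_space)
  have q: "q \<in> increasing_funs"
    using P.mono_I by (simp add: increasing_funs_def q_def mono_on_def)
  have [measurable]: "q \<in> borel_measurable borel"
    using P.measurable_CI unfolding q_def by (subst (asm) borel_measurable_restrict_space_iff) auto
  have id [measurable]: "(\<lambda>\<tau>. \<tau>) \<in> borel_measurable unit_lborel"
    by (auto intro: measurable_restrict_space1)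
  interpret J: prob_space unit_lborel by (rule prob_space_unit_lborel)
  define \<gamma> where "\<gamma> = distr unit_lborel (borel \<Otimes>\<^sub>M borel) (\<lambda>\<tau>. (q \<tau>, \<tau>))"
  have "distr \<gamma> P fst = distr unit_lborel P q"
    unfolding \<gamma>_def by (subst distr_distr) (auto simp: comp_def)
  also have "\<dots> = distr unit_lborel borel P.I"
    by (intro distr_cong) (auto simp: q_eq)
  finally have 1: "distr \<gamma> P fst = P"
    by (simp add: P.distr_I_eq_M)
  have "distr \<gamma> (uniform_measure lborel {0..1}) snd =
      distr unit_lborel (uniform_measure lborel {0..1}) (\<lambda>\<tau>. \<tau>)"
    unfolding \<gamma>_def by (subst distr_distr) (auto simp: comp_def)
  also have "\<dots> = distr unit_lborel borel (\<lambda>\<tau>. \<tau>)"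
    by (intro distr_cong) auto
  finally have 2: "distr \<gamma> (uniform_measure lborel {0..1}) snd = uniform_measure lborel {0..1}"
    by (simp add: distr_unit_lborel)
  have "prob_space \<gamma>"
    unfolding \<gamma>_def by (rule J.prob_space_distr) measurable
  then have \<gamma>: "\<gamma> \<in> couplings P (uniform_measure lborel {0..1})"
    using 1 2 by (auto simp: couplings_def \<gamma>_def cong: sets_pair_measure_cong)
  have "AE x in \<gamma>. fst x = q (snd x)"
    unfolding \<gamma>_def by (subst AE_distr_iff) auto
  with q \<gamma> show thesis by (rule that)
qed

section \<open>Duality between increasing functions and couplings\<close>

theorem expected_check_loss_eq_w2_inner:
  assumes "prob_space M" and Z: "integrable M Z"
  shows "enn2ereal (INF q\<in>increasing_funs. expected_check_loss M Z q) + ereal (1/2 * (\<integral>\<omega>. Z \<omega> \<partial>M))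
    = w2_inner (distr M borel Z) (uniform_measure lborel {0..1})"
    (is "enn2ereal ?inf + _ = w2_inner ?P ?U")
proof -
  interpret M: prob_space M by fact
  define m where "m = 1/2 * (\<integral>\<omega>. Z \<omega> \<partial>M)"
  have [measurable]: "Z \<in> borel_measurable M" using Z by auto
  have P: "sets ?P = sets borel" "integrable ?P (\<lambda>z. z)"
    using Z by (auto simp: integrable_distr_eq)
  \<comment> \<open>The first marginal of a coupling is the law of \<open>Z\<close>, so mean and
    loss may be computed on either space.\<close>
  have mean: "(\<integral>x. fst x \<partial>\<gamma>) = 2 * m"
    and loss: "q \<in> increasing_funs \<Longrightarrow> expected_check_loss \<gamma> fst q = expected_check_loss M Z q"
    if \<gamma>: "\<gamma> \<in> couplings ?P ?U" for \<gamma> q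
  proof -
    interpret C: uniform_coupling \<gamma> fst snd
      by (rule uniform_coupling_couplings[OF \<gamma> P])
    note d = distr_coupling_fst[OF \<gamma> P(1)]
    have "(\<integral>x. fst x \<partial>\<gamma>) = (\<integral>z. z \<partial>distr \<gamma> borel fst)"
      by (rule integral_distr[symmetric, OF C.Z_meas]) simp
    also have "\<dots> = (\<integral>\<omega>. Z \<omega> \<partial>M)"
      unfolding d by (rule integral_distr) simp_all
    finally show "(\<integral>x. fst x \<partial>\<gamma>) = 2 * m"
      by (simp add: m_def)
    show "expected_check_loss \<gamma> fst q = expected_check_loss M Z q" if q: "q \<in> increasing_funs"
    proof -
      note q_meas = increasing_funs_measurable[OF q]
      have "expected_check_loss \<gamma> fst q = expected_check_loss (distr \<gamma> borel fst) (\<lambda>z. z) q"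
        by (rule expected_check_loss_distr[symmetric, OF q_meas C.Z_meas])
      also have "\<dots> = expected_check_loss M Z q"
        unfolding d by (rule expected_check_loss_distr[OF q_meas]) simp
      finally show ?thesis .
    qed
  qed
  \<comment> \<open>Weak duality, for an arbitrary coupling and an arbitrary increasing
    function.\<close>
  have le: "ereal (\<integral>x. fst x * snd x \<partial>\<gamma>) \<le> enn2ereal (expected_check_loss M Z q) + ereal m"
    if \<gamma>: "\<gamma> \<in> couplings ?P ?U" and q: "q \<in> increasing_funs" for \<gamma> q
  proof -
    interpret C: uniform_coupling \<gamma> fst snd
      by (rule uniform_coupling_couplings[OF \<gamma> P])
    have "ennreal ((\<integral>x. fst x * snd x \<partial>\<gamma>) - m) \<le> expected_check_loss M Z q"
      using C.expected_check_loss_ge[OF increasing_funs_measurable[OF q]]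
      by (simp add: mean[OF \<gamma>] loss[OF \<gamma> q])
    \<comment> \<open>An \<open>ennreal\<close> of a real corresponds to its maximum with 0, so
      dropping this maximum weakens the bound.\<close>
    then have "ereal ((\<integral>x. fst x * snd x \<partial>\<gamma>) - m) \<le> enn2ereal (expected_check_loss M Z q)"
      by (simp add: less_eq_ennreal.rep_eq ennreal.rep_eq)
    then show ?thesis
      by (cases "enn2ereal (expected_check_loss M Z q)") auto
  qed
  have "real_distribution ?P"
    by (simp add: real_distribution_def real_distribution_axioms_def M.prob_space_distr)
  then obtain q \<gamma> where q: "q \<in> increasing_funs" and \<gamma>: "\<gamma> \<in> couplings ?P ?U"
    and AE: "AE x in \<gamma>. fst x = q (snd x)"
    by (rule quantile_coupling)
  interpret C: uniform_coupling \<gamma> fst snd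
    by (rule uniform_coupling_couplings[OF \<gamma> P])
  have eq: "enn2ereal (expected_check_loss M Z q) + ereal m = ereal (\<integral>x. fst x * snd x \<partial>\<gamma>)"
    using C.expected_check_loss_quantile[OF q AE] by (simp add: mean[OF \<gamma>] loss[OF \<gamma> q])
  \<comment> \<open>The pair of \<open>q\<close> and \<gamma> attains equality in weak duality.
    Hence \<open>q\<close> minimizes the loss, and \<gamma> maximizes the coupling integral.\<close>
  have inf: "?inf = expected_check_loss M Z q"
  proof (rule antisym)
    show "?inf \<le> expected_check_loss M Z q"
      using q by (rule INF_lower)
    show "expected_check_loss M Z q \<le> ?inf"
    proof (rule INF_greatest)
      fix q' assume "q' \<in> increasing_funs"
      from le[OF \<gamma> this] eq have
        "enn2ereal (expected_check_loss M Z q) + ereal m \<le>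
          enn2ereal (expected_check_loss M Z q') + ereal m" by simp
      \<comment> \<open>The summand \<open>m\<close> is finite and therefore cancels in the extended
        reals.\<close>
      then show "expected_check_loss M Z q \<le> expected_check_loss M Z q'"
        by (simp add: ereal_add_le_add_iff2 less_eq_ennreal.rep_eq)
    qed
  qed
  have sup: "w2_inner ?P ?U = ereal (\<integral>x. fst x * snd x \<partial>\<gamma>)"
    unfolding w2_inner_def
  proof (rule antisym)
    show "(SUP \<gamma>\<in>couplings ?P ?U. ereal (\<integral>z. fst z * snd z \<partial>\<gamma>)) \<le> ereal (\<integral>x. fst x * snd x \<partial>\<gamma>)"
      using le[OF _ q] by (intro SUP_least) (simp add: eq)
  qed (use \<gamma> in \<open>rule SUP_upper\<close>)
  show ?thesis
    unfolding inf sup using eq by (simp add: m_def)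
qed

section \<open>Residuals of the linear model\<close>

theorem lemma2:
  fixes M :: "'a measure" and N :: "'b measure"
    and X :: "'a \<Rightarrow> real ^ 'p" and Y \<epsilon> :: "'a \<Rightarrow> real" and U :: "'b \<Rightarrow> real"
    and bstar b :: "real ^ 'p"
  assumes "prob_space M"
    and "X \<in> borel_measurable M"
    and "integrable M (\<lambda>\<omega>. (norm (X \<omega>))\<^sup>2)"
    and "(\<integral>\<omega>. X \<omega> \<partial>M) = 0"
    and "\<epsilon> \<in> borel_measurable M"
    and "\<And>\<omega>. \<omega> \<in> space M \<Longrightarrow> Y \<omega> = bstar \<bullet> X \<omega> + \<epsilon> \<omega>"
    and "integrable M (\<lambda>\<omega>. (Y \<omega>)\<^sup>2)"
    and "prob_space N"
    and "U \<in> borel_measurable N"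
    and "distr N borel U = uniform_measure lborel {0..1}"
  shows "enn2ereal (INF q\<in>increasing_funs. expected_check_loss M (\<lambda>\<omega>. Y \<omega> - b \<bullet> X \<omega>) q)
           + ereal (1 / 2 * (\<integral>\<omega>. Y \<omega> \<partial>M))
         = w2_inner_rv M (\<lambda>\<omega>. Y \<omega> - b \<bullet> X \<omega>) N U"
proof -
  interpret prob_space M by fact
  note [measurable] = assms(2,5)
  \<comment> \<open>Measurability of \<open>Y\<close> is read off from the linear model, whose
    equation holds on all of \<open>space M\<close>.\<close>
  have "(\<lambda>\<omega>. bstar \<bullet> X \<omega> + \<epsilon> \<omega>) \<in> borel_measurable M"
    by measurable
  then have [measurable]: "Y \<in> borel_measurable M"
    by (subst measurable_cong[OF assms(6)])
  have Y: "integrable M Y"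
    by (rule square_integrable_imp_integrable) (use assms(7) in measurable)
  have "integrable M (\<lambda>\<omega>. norm (X \<omega>))"
    by (rule square_integrable_imp_integrable) (use assms(3) in measurable)
  then have X: "integrable M X"
    by (simp add: integrable_norm_iff)
  \<comment> \<open>Since \<open>X\<close> is centred, the residual has the mean of
    \<open>Y\<close>, which turns the mean term of the general identity into the stated one.\<close>
  have "(\<integral>\<omega>. Y \<omega> - b \<bullet> X \<omega> \<partial>M) = (\<integral>\<omega>. Y \<omega> \<partial>M)"
    using X Y assms(4) by simp
  moreover have "integrable M (\<lambda>\<omega>. Y \<omega> - b \<bullet> X \<omega>)"
    using X Y by auto
  ultimately show ?thesis
    using expected_check_loss_eq_w2_inner[OF assms(1), of "\<lambda>\<omega>. Y \<omega> - b \<bullet> X \<omega>"]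
    unfolding w2_inner_rv_def assms(10) by simp
qed

end
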